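(* Let $\Omega=\{x\in\mathbb{R}^n : g(x)\le 0\}$, where $g=(g_1,\dots,g_m):\mathbb{R}^n\to\mathbb{R}^m$ has convex and differentiable components, and let $\bar x\in\Omega$ be given. Assume that $\Omega$ satisfies the Slater condition, i.e., there exists $\hat x\in\mathbb{R}^n$ such that $g(\hat x)<0$ (componentwise). Define $J(\bar x)=\{j\in\{1,\dots,m\} : g_j(\bar x)=0\}$ and let $d$ be the circumcentric direction of the cone $\operatorname{cone}(\{\nabla g_j(\bar x)\}_{j\in J(\bar x)})$. Then, for each $v\in\mathbb{R}^n$ satisfying $\|v\|<\|d\|^2$, there exists $\delta_v>0$ such that $\bar x+t(d+v)\in\Omega$ for all $t\in[0,\delta_v]$.
   Context: $\mathbb{R}^n$ carries the Euclidean norm $\|\cdot\|$; vector inequalities are componentwise. For $X\subset\mathbb{R}^n$, $\operatorname{cone}(X)$ is the set of all conic combinations (finite linear combinations with nonnegative coefficients) of elements of $X$, with $\operatorname{cone}(\emptyset)=\{0\}$. Circumcenter: for a finite set $S=\{u^1,\dots,u^p\}\subset\mathbb{R}^n$ ($p\ge 1$), the circumcenter $\operatorname{circ}(S)$ is the point $c$ (unique if it exists) such that $c\in\operatorname{aff}(S)$ (the smallest affine subspace containing $S$) and $\|c-u^1\|=\cdots=\|c-u^p\|$. A finite set $B_K\subset\mathbb{R}^n$ is a conic base of a finitely generated cone $K$ if it has minimal cardinality among the finite sets $B$ with $\operatorname{cone}(B)=K$; it is normalized if all its vectors have norm one. Circumcentric direction: if $K\neq\{0\}$ is a polyhedral (equivalently,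 finitely generated) cone and $B_K$ is a normalized conic base of $K$, the circumcentric direction of $K$ is $d_{\operatorname{circ}}(K)=-\operatorname{circ}(B_K)$ (this exists and does not depend on the choice of $B_K$). If $K=\{0\}$, its circumcentric direction is $0$. *)

theory Defs
  imports "HOL-Analysis.Analysis"
begin

definition gradient :: "('a::real_inner \<Rightarrow> real) \<Rightarrow> 'a \<Rightarrow> 'a" where
  "gradient f x = (THE D. GDERIV f x :> D)"

text \<open>
  The library's \<open>cone hull X\<close> closes \<open>X\<close> under nonnegative scaling only, and
  \<open>cone hull {} = {}\<close>. Here sums are included as well, and the empty
  combination gives \<open>conical_hull {} = {0}\<close>.
\<close>

definition conical_hull :: "'a::real_vector set \<Rightarrow> 'a set" where
  "conical_hull X =
     {x. \<exists>F c. finite F \<and> F \<subseteq> X \<and> (\<forall>u\<in>F. 0 \<le> c u) \<and> x = (\<Sum>u\<in>F. c u *\<^sub>R u)}"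

definition is_circumcenter :: "'a::real_inner set \<Rightarrow> 'a \<Rightarrow> bool" where
  "is_circumcenter S c \<longleftrightarrow>
     c \<in> affine hull S \<and> (\<forall>u\<in>S. \<forall>w\<in>S. norm (c - u) = norm (c - w))"

definition circumcenter :: "'a::real_inner set \<Rightarrow> 'a" where
  "circumcenter S = (THE c. is_circumcenter S c)"

definition conic_base :: "'a::real_vector set \<Rightarrow> 'a set \<Rightarrow> bool" where
  "conic_base K B \<longleftrightarrow> finite B \<and> conical_hull B = K \<and>
     (\<forall>B'. finite B' \<and> conical_hull B' = K \<longrightarrow> card B \<le> card B')"

definition normalized_conic_base :: "'a::real_normed_vector set \<Rightarrow> 'a set \<Rightarrow> bool" where
  "normalized_conic_base K B \<longleftrightarrow> conic_base K B \<and> (\<forall>u\<in>B. norm u = 1)"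

text \<open>
  Normalized conic bases need not be unique (when \<open>K\<close> contains a line);
  \<open>circumcentric_direction_eq\<close> below shows that the choice made by \<open>SOME\<close>
  is immaterial.
\<close>

definition circumcentric_direction :: "'a::real_inner set \<Rightarrow> 'a" where
  "circumcentric_direction K =
     (if K = {0} then 0 else - circumcenter (SOME B. normalized_conic_base K B))"

lemma is_circumcenter_unique:
  assumes "is_circumcenter S c" "is_circumcenter S c'"
  shows "c = c'"
proof (cases "S = {}")
  case True
  then show ?thesis using assms by (simp add: is_circumcenter_def)
next
  case False
  then obtain b where b: "b \<in> S" by blast
  have orth: "(c - c') \<bullet> u = (c - c') \<bullet> b" if "u \<in> S" for u
  proof -
    have "norm (c - u) = norm (c - b)" "norm (c' - u) = norm (c' - b)"
      using assms that b unfolding is_circumcenter_def by blast+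
    then have "(c - u) \<bullet> (c - u) = (c - b) \<bullet> (c - b)" "(c' - u) \<bullet> (c' - u) = (c' - b) \<bullet> (c' - b)"
      by (simp_all add: norm_eq)
    then show ?thesis by (simp add: inner_diff inner_commute)
  qed
  have "affine {x. (c - c') \<bullet> x = (c - c') \<bullet> b}"
    by (rule affine_hyperplane)
  with orth have "affine hull S \<subseteq> {x. (c - c') \<bullet> x = (c - c') \<bullet> b}"
    by (intro hull_minimal) auto
  moreover have "c \<in> affine hull S" "c' \<in> affine hull S"
    using assms unfolding is_circumcenter_def by blast+
  ultimately have "(c - c') \<bullet> c = (c - c') \<bullet> c'"
    by (metis (mono_tags, lifting) mem_Collect_eq subsetD)
  then have "(c - c') \<bullet> (c - c') = 0" by (simp add: inner_diff_right)
  then show ?thesis by simp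
qed

lemma circumcenter_eqI: "is_circumcenter S c \<Longrightarrow> circumcenter S = c"
  unfolding circumcenter_def using is_circumcenter_unique by blast

lemma is_circumcenter_circumcenter:
  fixes B :: "'a::euclidean_space set"
  assumes "B \<noteq> {}" and unit: "\<forall>u\<in>B. norm u = 1"
  shows "is_circumcenter B (circumcenter B)"
proof -
  let ?A = "affine hull B" let ?c = "closest_point (affine hull B) 0"
  have ne: "?A \<noteq> {}" using assms by simp
  have cl: "closed ?A" and cv: "convex ?A"
    by (simp_all add: closed_affine_hull affine_imp_convex)
  have cA: "?c \<in> ?A" and min: "\<forall>y\<in>?A. dist 0 ?c \<le> dist 0 y"
    using closest_point_exists[OF cl ne, of 0] by blast+
  have le: "- ?c \<bullet> (x - ?c) \<le> 0" if "x \<in> ?A" for x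
    using any_closest_point_dot[OF cv cl cA that min] by simp
  have eq: "?c \<bullet> (u - ?c) = 0" if "u \<in> B" for u
  proof -
    have u: "u \<in> ?A" using that by (simp add: hull_inc)
    have "2 *\<^sub>R ?c + (-1) *\<^sub>R u \<in> ?A"
      using cA u by (intro mem_affine) auto
    from le[OF this] le[OF u] show ?thesis
      by (simp add: inner_diff_right scaleR_2 inner_add_right)
  qed
  have "(norm (?c - u))\<^sup>2 = 1 - (norm ?c)\<^sup>2" if "u \<in> B" for u
    using eq[OF that] unit that
    by (simp add: power2_norm_eq_inner inner_diff inner_commute norm_eq_1)
  then have "norm (?c - u) = norm (?c - w)" if "u \<in> B" "w \<in> B" for u w
    using that by (metis norm_ge_zero power2_eq_imp_eq)
  then have "is_circumcenter B ?c"
    using cA unfolding is_circumcenter_def by blast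
  then show ?thesis using circumcenter_eqI by metis
qed

lemma conical_hull_finite:
  assumes "finite B"
  shows "conical_hull B = {x. \<exists>c. (\<forall>u\<in>B. 0 \<le> c u) \<and> x = (\<Sum>u\<in>B. c u *\<^sub>R u)}"
proof (intro equalityI subsetI)
  fix x assume "x \<in> conical_hull B"
  then obtain F c where F: "finite F" "F \<subseteq> B" "\<forall>u\<in>F. 0 \<le> c u" "x = (\<Sum>u\<in>F. c u *\<^sub>R u)"
    unfolding conical_hull_def by blast
  have "x = (\<Sum>u\<in>B. (if u \<in> F then c u else 0) *\<^sub>R u)"
    unfolding F(4) using assms F(2) by (intro sum.mono_neutral_cong_left) auto
  with F(3) show "x \<in> {x. \<exists>c. (\<forall>u\<in>B. 0 \<le> c u) \<and> x = (\<Sum>u\<in>B. c u *\<^sub>R u)}"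
    by (intro CollectI exI[of _ "\<lambda>u. if u \<in> F then c u else 0"]) auto
next
  fix x assume "x \<in> {x. \<exists>c. (\<forall>u\<in>B. 0 \<le> c u) \<and> x = (\<Sum>u\<in>B. c u *\<^sub>R u)}"
  then show "x \<in> conical_hull B" using assms unfolding conical_hull_def by blast
qed

lemma conical_hull_inc: "u \<in> B \<Longrightarrow> u \<in> conical_hull B"
  unfolding conical_hull_def by (auto intro!: exI[of _ "{u}"] exI[of _ "\<lambda>_. 1"])

lemma conical_hull_sum:
  assumes "finite I" "\<And>i. i \<in> I \<Longrightarrow> 0 \<le> a i" "\<And>i. i \<in> I \<Longrightarrow> f i \<in> conical_hull B" "finite B"
  shows "(\<Sum>i\<in>I. a i *\<^sub>R f i) \<in> conical_hull B"
proof -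
  have "\<forall>i\<in>I. \<exists>c. (\<forall>u\<in>B. 0 \<le> c u) \<and> f i = (\<Sum>u\<in>B. c u *\<^sub>R u)"
    using assms(3) by (auto simp: conical_hull_finite[OF assms(4)])
  then obtain c where c: "\<forall>i\<in>I. (\<forall>u\<in>B. 0 \<le> c i u) \<and> f i = (\<Sum>u\<in>B. c i u *\<^sub>R u)"
    by metis
  have "(\<Sum>i\<in>I. a i *\<^sub>R f i) = (\<Sum>i\<in>I. \<Sum>u\<in>B. (a i * c i u) *\<^sub>R u)"
    using c by (simp add: scaleR_right.sum)
  also have "\<dots> = (\<Sum>u\<in>B. (\<Sum>i\<in>I. a i * c i u) *\<^sub>R u)"
    by (subst sum.swap) (simp add: scaleR_left.sum)
  finally show ?thesis
    using c assms(2)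
    by (auto simp: conical_hull_finite[OF assms(4)] sum_nonneg
        intro!: exI[of _ "\<lambda>u. \<Sum>i\<in>I. a i * c i u"])
qed

lemma conical_hull_minimal:
  assumes "finite B" "finite B'" "B \<subseteq> conical_hull B'"
  shows "conical_hull B \<subseteq> conical_hull B'"
proof
  fix x assume "x \<in> conical_hull B"
  then obtain c where c: "\<forall>u\<in>B. 0 \<le> c u" and x: "x = (\<Sum>u\<in>B. c u *\<^sub>R u)"
    unfolding conical_hull_finite[OF assms(1)] by blast
  show "x \<in> conical_hull B'"
    unfolding x using assms c by (intro conical_hull_sum) auto
qed

lemma conic_base_irredundant:
  assumes "conic_base K B" "b \<in> B"
  shows "b \<notin> conical_hull (B - {b})"
proof
  assume b: "b \<in> conical_hull (B - {b})"
  have fin: "finite B" and K: "conical_hull B = K" using assms by (auto simp: conic_base_def)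
  have "conical_hull (B - {b}) = K"
    unfolding K[symmetric] using fin b
    by (intro equalityI conical_hull_minimal subsetI) (auto intro: conical_hull_inc)
  then have "card B \<le> card (B - {b})" using assms fin unfolding conic_base_def by blast
  moreover have "card (B - {b}) < card B" using assms(2) fin by (rule card_Diff1_less[rotated])
  ultimately show False by simp
qed

lemma normalized_conic_base_exists:
  fixes F :: "'a::real_normed_vector set"
  assumes "finite F"
  shows "\<exists>B. normalized_conic_base (conical_hull F) B"
proof -
  obtain B where B: "finite B" "conical_hull B = conical_hull F"
    and min: "\<And>B'. finite B' \<and> conical_hull B' = conical_hull F \<Longrightarrow> card B \<le> card B'"
    using ex_has_least_nat[of "\<lambda>B. finite B \<and> conical_hull B = conical_hull F" F card] assms
    by blast
  have base: "conic_base (conical_hull F) B" using B min by (auto simp: conic_base_def)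
  have nz: "u \<noteq> 0" if "u \<in> B" for u
  proof
    assume "u = 0"
    then have "u \<in> conical_hull (B - {u})"
      unfolding conical_hull_def by (auto intro!: exI[of _ "{}"])
    with conic_base_irredundant[OF base that] show False by simp
  qed
  let ?B = "sgn ` B"
  have one: "\<forall>u\<in>?B. norm u = 1" using nz by (auto simp: norm_sgn)
  have fin: "finite ?B" using B by simp
  have scale: "a *\<^sub>R u \<in> conical_hull X" if "u \<in> X" "0 \<le> a" for a :: real and u :: 'a and X
    using that unfolding conical_hull_def by (auto intro!: exI[of _ "{u}"] exI[of _ "\<lambda>_. a"])
  have "?B \<subseteq> conical_hull B" using scale by (auto simp: sgn_div_norm)
  moreover have "u \<in> conical_hull ?B" if "u \<in> B" for u
  proof -
    have "u = norm u *\<^sub>R sgn u" using nz[OF that] by (simp add: sgn_div_norm)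
    then show ?thesis using scale[of "sgn u" ?B "norm u"] that by auto
  qed
  ultimately have "conical_hull ?B = conical_hull F"
    using conical_hull_minimal[OF fin B(1)] conical_hull_minimal[OF B(1) fin] B(2) by blast
  moreover have "card ?B \<le> card B" using B(1) by (rule card_image_le)
  ultimately have "conic_base (conical_hull F) ?B"
    using base fin le_trans unfolding conic_base_def by blast
  with one show ?thesis unfolding normalized_conic_base_def by blast
qed

lemma normalized_conic_base_subset_of_pointed:
  assumes nb: "normalized_conic_base K B" "normalized_conic_base K B'"
    and pointed: "\<And>x. x \<in> K \<Longrightarrow> - x \<in> K \<Longrightarrow> x = 0"
  shows "B \<subseteq> B'"
proof
  fix b assume b: "b \<in> B"
  have fin: "finite B" "finite B'" and K: "conical_hull B = K" "conical_hull B' = K"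
    and unit: "\<And>u. u \<in> B \<union> B' \<Longrightarrow> norm u = 1" and base: "conic_base K B"
    using nb by (auto simp: normalized_conic_base_def conic_base_def)
  have "b \<in> conical_hull B'" using b conical_hull_inc K by blast
  then obtain m where m: "\<forall>u\<in>B'. 0 \<le> m u" "b = (\<Sum>u\<in>B'. m u *\<^sub>R u)"
    by (auto simp: conical_hull_finite[OF fin(2)])
  have "b \<noteq> 0" using unit[of b] b by auto
  then obtain w where w: "w \<in> B'" "m w \<noteq> 0"
    using m(2) by (metis (no_types, lifting) scaleR_zero_left sum.neutral)
  then have mw: "m w > 0" using m(1) by (simp add: order_less_le)
  define r where "r = (\<Sum>u\<in>B' - {w}. m u *\<^sub>R u)"
  have bw: "b = m w *\<^sub>R w + r"
    unfolding r_def m(2) using fin(2) w(1) by (simp add: sum.remove)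
  have rK: "r \<in> conical_hull B" unfolding r_def
    using fin m(1) K conical_hull_inc by (intro conical_hull_sum) blast+
  have wK: "w \<in> conical_hull B" using w(1) K conical_hull_inc by blast
  obtain p where p: "\<forall>u\<in>B. 0 \<le> p u" "w = (\<Sum>u\<in>B. p u *\<^sub>R u)"
    using wK by (auto simp: conical_hull_finite[OF fin(1)])
  obtain q where q: "\<forall>u\<in>B. 0 \<le> q u" "r = (\<Sum>u\<in>B. q u *\<^sub>R u)"
    using rK by (auto simp: conical_hull_finite[OF fin(1)])
  define s where "s = (\<lambda>u. m w * p u + q u)"
  have s0: "\<forall>u\<in>B. 0 \<le> s u" using p(1) q(1) mw by (simp add: s_def)
  have "b = (\<Sum>u\<in>B. s u *\<^sub>R u)"
    using bw p(2) q(2) by (simp add: s_def scaleR_add_left sum.distrib scaleR_right.sum)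
  then have bs: "b = s b *\<^sub>R b + (\<Sum>u\<in>B - {b}. s u *\<^sub>R u)"
    using fin(1) b by (simp add: sum.remove)
  define t where "t = (\<Sum>u\<in>B - {b}. s u *\<^sub>R u)"
  have t: "t = (1 - s b) *\<^sub>R b" using bs by (simp add: t_def algebra_simps)
  have "s b \<ge> 1"
  proof (rule ccontr)
    assume "\<not> s b \<ge> 1"
    then have "b = (\<Sum>u\<in>B - {b}. (s u / (1 - s b)) *\<^sub>R u)" "1 - s b > 0"
      using arg_cong[OF t, of "\<lambda>x. (1 / (1 - s b)) *\<^sub>R x"]
      by (simp_all add: t_def scaleR_right.sum)
    then have "b \<in> conical_hull (B - {b})"
      using s0 fin(1) by (auto simp: conical_hull_finite intro!: exI[of _ "\<lambda>u. s u / (1 - s b)"])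
    with conic_base_irredundant[OF base b] show False by simp
  qed
  have sc: "(\<Sum>u\<in>B. c u *\<^sub>R u) \<in> K" if "\<forall>u\<in>B. 0 \<le> c u" for c
    using that K(1) conical_hull_finite[OF fin(1)] by blast
  have zero: "s u = 0" if u: "u \<in> B" "u \<noteq> b" for u
  proof -
    have pos: "s u *\<^sub>R u \<in> K"
      using sc[of "\<lambda>v. if v = u then s u else 0"] s0 u fin(1)
      by (simp add: if_distrib[of "\<lambda>c. c *\<^sub>R _"] sum.delta cong: if_cong)
    have "(\<Sum>v\<in>B. (if v = u then 0 else if v = b then s b - 1 else s v) *\<^sub>R v)
        = (s b - 1) *\<^sub>R b + (t - s u *\<^sub>R u)"
    proof -
      have "(\<Sum>v\<in>B. (if v = u then 0 else if v = b then s b - 1 else s v) *\<^sub>R v)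
          = (s b - 1) *\<^sub>R b + (\<Sum>v\<in>B - {b}. (if v = u then 0 else if v = b then s b - 1 else s v) *\<^sub>R v)"
        using fin(1) b u by (simp add: sum.remove)
      also have "(\<Sum>v\<in>B - {b}. (if v = u then 0 else if v = b then s b - 1 else s v) *\<^sub>R v)
          = (\<Sum>v\<in>B - {b} - {u}. s v *\<^sub>R v)"
        using fin(1) u by (intro sum.mono_neutral_cong_right) auto
      also have "\<dots> = t - s u *\<^sub>R u"
        unfolding t_def using fin(1) u by (simp add: sum_diff1)
      finally show ?thesis .
    qed
    also have "\<dots> = - (s u *\<^sub>R u)" using t by (simp add: algebra_simps)
    finally have "- (s u *\<^sub>R u) \<in> K"
      using sc[of "\<lambda>v. if v = u then 0 else if v = b then s b - 1 else s v"] s0 \<open>s b \<ge> 1\<close> by auto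
    with pos have "s u *\<^sub>R u = 0" by (rule pointed)
    moreover have "u \<noteq> 0" using unit[of u] u by auto
    ultimately show ?thesis by simp
  qed
  have "p u = 0" if "u \<in> B" "u \<noteq> b" for u
  proof -
    have "0 \<le> m w * p u" "0 \<le> q u" using that p(1) q(1) mw by auto
    with zero[OF that] have "m w * p u = 0" unfolding s_def by linarith
    with mw show ?thesis by simp
  qed
  then have "w = p b *\<^sub>R b"
    unfolding p(2) using fin(1) b by (subst sum.remove[of _ b]) auto
  moreover from this have "\<bar>p b\<bar> = 1" using unit[of w] unit[of b] w(1) b by auto
  ultimately have "w = b" using p(1) b by force
  with w(1) show "b \<in> B'" by simp
qed

lemma circumcenter_normalized_conic_base_of_line:
  assumes nb: "normalized_conic_base K B" and x: "x \<in> K" "- x \<in> K" "x \<noteq> 0"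
  shows "circumcenter B = 0"
proof (rule circumcenter_eqI)
  have fin: "finite B" and K: "conical_hull B = K" and unit: "\<And>u. u \<in> B \<Longrightarrow> norm u = 1"
    using nb by (auto simp: normalized_conic_base_def conic_base_def)
  obtain p where p: "\<forall>u\<in>B. 0 \<le> p u" "x = (\<Sum>u\<in>B. p u *\<^sub>R u)"
    using x(1) K by (auto simp: conical_hull_finite[OF fin])
  obtain q where q: "\<forall>u\<in>B. 0 \<le> q u" "- x = (\<Sum>u\<in>B. q u *\<^sub>R u)"
    using x(2) K by (auto simp: conical_hull_finite[OF fin])
  define a where "a = (\<Sum>u\<in>B. p u + q u)"
  have "a \<noteq> 0"
  proof
    assume "a = 0"
    then have "\<forall>u\<in>B. p u + q u = 0"
      unfolding a_def using fin p(1) q(1) by (subst (asm) sum_nonneg_eq_0_iff) auto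
    then have "\<forall>u\<in>B. p u = 0" using p(1) q(1) by (simp add: add_nonneg_eq_0_iff)
    with p(2) x(3) show False by simp
  qed
  have "(\<Sum>u\<in>B. ((p u + q u) / a) *\<^sub>R u) = (1 / a) *\<^sub>R (\<Sum>u\<in>B. (p u + q u) *\<^sub>R u)"
    by (simp add: scaleR_right.sum)
  also have "(\<Sum>u\<in>B. (p u + q u) *\<^sub>R u) = x + - x"
    by (simp only: scaleR_add_left sum.distrib flip: p(2) q(2))
  finally have z: "(\<Sum>u\<in>B. ((p u + q u) / a) *\<^sub>R u) = 0" by simp
  have "(\<Sum>u\<in>B. (p u + q u) / a) = 1"
    using \<open>a \<noteq> 0\<close> by (simp add: a_def sum_divide_distrib[symmetric])
  then have "0 \<in> affine hull B" using z by (auto simp: affine_hull_finite[OF fin])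
  then show "is_circumcenter B 0" using unit by (simp add: is_circumcenter_def)
qed

lemma circumcentric_direction_eq:
  assumes "K \<noteq> {0}" "normalized_conic_base K B"
  shows "circumcentric_direction K = - circumcenter B"
proof -
  let ?B = "SOME B. normalized_conic_base K B"
  have nb: "normalized_conic_base K ?B" using assms(2) by (rule someI)
  have "circumcenter ?B = circumcenter B"
  proof (cases "\<exists>x. x \<in> K \<and> - x \<in> K \<and> x \<noteq> 0")
    case True
    then show ?thesis
      using circumcenter_normalized_conic_base_of_line nb assms(2) by metis
  next
    case False
    then have "?B = B"
      using normalized_conic_base_subset_of_pointed nb assms(2) by (metis subset_antisym)
    then show ?thesis by simp
  qed
  with assms(1) show ?thesis by (simp add: circumcentric_direction_def)
qed

end

theory Submission
  imports Defs
begin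

text \<open>
  The circumcenter of the unit vectors spanning the cone is the point of their affine hull closest
  to the origin, so the circumcentric direction \<open>d\<close> makes the same inner product
  \<open>- (norm d)\<^sup>2\<close> with all of them. By Cauchy--Schwarz, \<open>d + v\<close> still has a negative inner product
  with every generator, hence with every nonzero vector of the cone. By convexity and the Slater
  condition the active gradients are nonzero, so \<open>d + v\<close> is a strict descent direction for every
  active constraint.
\<close>

text \<open>The derivative \<open>f'\<close> is linear, so its adjoint applied to \<open>1\<close>
  represents it as an inner product. Uniqueness of the derivative then makes the description behind
  \<open>gradient\<close> well defined.\<close>

lemma GDERIV_gradient:
  fixes f :: "'a::euclidean_space \<Rightarrow> real"
  assumes "f differentiable (at x)"
  shows "GDERIV f x :> gradient f x"
proof -
  obtain f' where f': "(f has_derivative f') (at x)"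
    using assms unfolding differentiable_def by blast
  have "f' = (\<lambda>h. h \<bullet> adjoint f' 1)"
    using adjoint_works[OF has_derivative_linear[OF f'], of _ 1] by auto
  with f' have ex: "GDERIV f x :> adjoint f' 1"
    unfolding gderiv_def by simp
  have "D = E" if "GDERIV f x :> D" "GDERIV f x :> E" for D E
  proof -
    have "(\<lambda>h. h \<bullet> D) = (\<lambda>h. h \<bullet> E)"
      using that unfolding gderiv_def by (rule has_derivative_unique)
    then show ?thesis by (simp add: fun_eq_iff vector_eq_ldot)
  qed
  from ex this[OF _ ex] show ?thesis
    unfolding gradient_def by (rule theI)
qed

lemma GDERIV_along_line:
  assumes "GDERIV f x :> D"
  shows "((\<lambda>t. f (x + t *\<^sub>R w)) has_real_derivative w \<bullet> D) (at 0)"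
proof -
  have "((\<lambda>t. x + t *\<^sub>R w) has_derivative (\<lambda>t. t *\<^sub>R w)) (at 0)"
    by (auto intro!: derivative_eq_intros)
  moreover have "(f has_derivative (\<lambda>h. h \<bullet> D)) (at (x + 0 *\<^sub>R w))"
    using assms by (simp add: gderiv_def)
  ultimately have "((\<lambda>t. f (x + t *\<^sub>R w)) has_derivative (\<lambda>t. (t *\<^sub>R w) \<bullet> D)) (at 0)"
    by (rule has_derivative_compose)
  moreover have "(\<lambda>t. (t *\<^sub>R w) \<bullet> D) = (*) (w \<bullet> D)"
    by (simp add: fun_eq_iff)
  ultimately show ?thesis
    by (simp only: has_field_derivative_def)
qed

text \<open>Restricting \<open>f\<close> to the line through \<open>x\<close> and \<open>y\<close>
  reduces this to the one-dimensional tangent inequality, read off at parameter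
  \<open>1\<close>.\<close>

lemma convex_on_above_GDERIV:
  assumes "convex_on UNIV f" and "GDERIV f x :> D"
  shows "f x + (y - x) \<bullet> D \<le> f y"
proof -
  let ?\<phi> = "\<lambda>t. f (x + t *\<^sub>R (y - x))"
  have "convex_on UNIV ?\<phi>"
  proof (rule convex_onI)
    fix t a b :: real assume "0 < t" "t < 1"
    moreover have "x + ((1 - t) *\<^sub>R a + t *\<^sub>R b) *\<^sub>R (y - x)
        = (1 - t) *\<^sub>R (x + a *\<^sub>R (y - x)) + t *\<^sub>R (x + b *\<^sub>R (y - x))"
      by (simp add: algebra_simps)
    ultimately show "?\<phi> ((1 - t) *\<^sub>R a + t *\<^sub>R b) \<le> (1 - t) * ?\<phi> a + t * ?\<phi> b"
      using convex_onD[OF assms(1), of t] by simp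
  qed simp
  from convex_on_imp_above_tangent[OF this _ _ _ GDERIV_along_line[OF assms(2)], of 1]
  show ?thesis by simp
qed

text \<open>Equal distances to \<open>?c\<close> together with equal norms force equal inner
  products with \<open>?c\<close>. So \<open>B\<close> lies in a hyperplane normal to
  \<open>?c\<close>; the affine hull lies there too, and it contains \<open>?c\<close>
  itself.\<close>

lemma inner_circumcenter:
  fixes B :: "'a::euclidean_space set"
  assumes unit: "\<forall>u\<in>B. norm u = 1" and u: "u \<in> B"
  shows "circumcenter B \<bullet> u = (norm (circumcenter B))\<^sup>2"
proof -
  let ?c = "circumcenter B"
  have circ: "is_circumcenter B ?c"
    using is_circumcenter_circumcenter unit u by blast
  have "?c \<bullet> w = ?c \<bullet> u" if "w \<in> B" for w
  proof -
    have "norm (?c - w) = norm (?c - u)"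
      using circ that u unfolding is_circumcenter_def by blast
    moreover have "norm w = norm u"
      using unit that u by simp
    ultimately show ?thesis
      by (simp add: norm_eq inner_diff inner_commute)
  qed
  then have "affine hull B \<subseteq> {x. ?c \<bullet> x = ?c \<bullet> u}"
    by (intro hull_minimal affine_hyperplane) auto
  then show ?thesis
    using circ unfolding is_circumcenter_def power2_norm_eq_inner by fastforce
qed

lemma inner_conical_hull_neg:
  assumes "finite B" "\<And>u. u \<in> B \<Longrightarrow> w \<bullet> u < 0" "x \<in> conical_hull B" "x \<noteq> 0"
  shows "w \<bullet> x < 0"
proof -
  obtain c where c: "\<forall>u\<in>B. 0 \<le> c u" and x: "x = (\<Sum>u\<in>B. c u *\<^sub>R u)"
    using assms(3) by (auto simp: conical_hull_finite[OF assms(1)])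
  \<comment> \<open>Since \<open>x\<close> is nonzero, some coefficient is positive; its term makes
    the inequality strict.\<close>
  obtain b where b: "b \<in> B" "c b \<noteq> 0"
    using assms(4) x by (metis (no_types, lifting) scaleR_zero_left sum.neutral)
  have "(\<Sum>u\<in>B. c u * (w \<bullet> u)) < (\<Sum>u\<in>B. 0)"
  proof (rule sum_strict_mono_ex1[OF assms(1)])
    show "\<forall>u\<in>B. c u * (w \<bullet> u) \<le> 0"
      using c assms(2) by (simp add: mult_nonneg_nonpos order_less_imp_le)
    have "c b * (w \<bullet> b) < 0"
      using b c assms(2) by (intro mult_pos_neg) (auto simp: order_less_le)
    with b(1) show "\<exists>u\<in>B. c u * (w \<bullet> u) < 0" ..
  qed
  then show ?thesis by (simp add: x inner_sum_right)
qed

lemma inner_circumcentric_direction_neg: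
  fixes F :: "'a::euclidean_space set"
  assumes "finite F" and d: "d = circumcentric_direction (conical_hull F)"
    and v: "norm v < (norm d)\<^sup>2" and x: "x \<in> F" "x \<noteq> 0"
  shows "(d + v) \<bullet> x < 0"
proof -
  let ?K = "conical_hull F"
  have xK: "x \<in> ?K" using x(1) by (rule conical_hull_inc)
  obtain B where B: "normalized_conic_base ?K B"
    using normalized_conic_base_exists[OF assms(1)] by blast
  then have fin: "finite B" and K: "conical_hull B = ?K" and unit: "\<forall>u\<in>B. norm u = 1"
    by (auto simp: normalized_conic_base_def conic_base_def)
  \<comment> \<open>The nonzero \<open>x\<close> rules out the degenerate cone
    \<open>{0}\<close>.\<close>
  have dB: "d = - circumcenter B"
    unfolding d using xK x(2) B by (intro circumcentric_direction_eq) auto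
  have "(d + v) \<bullet> u < 0" if "u \<in> B" for u
  proof -
    have "d \<bullet> u = - (norm d)\<^sup>2"
      using inner_circumcenter[OF unit that] by (simp add: dB)
    moreover have "v \<bullet> u \<le> norm v"
      using norm_cauchy_schwarz[of v u] unit that by simp
    ultimately show ?thesis using v by (simp add: inner_add_left)
  qed
  then show ?thesis
    using inner_conical_hull_neg[OF fin] xK x(2) K by blast
qed

theorem corollary2p13:
  fixes g :: "real ^ 'n \<Rightarrow> real ^ 'm"
    and xbar d v :: "real ^ 'n"
    and \<Omega> :: "(real ^ 'n) set"
    and J :: "'m set"
  assumes Omega: "\<Omega> = {x. \<forall>j. g x $ j \<le> 0}"
    and convex: "\<And>j. convex_on UNIV (\<lambda>x. g x $ j)"
    and differentiable: "\<And>j x. (\<lambda>y. g y $ j) differentiable (at x)"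
    and xbar: "xbar \<in> \<Omega>"
    and Slater: "\<exists>xhat. \<forall>j. g xhat $ j < 0"
    and J: "J = {j. g xbar $ j = 0}"
    and d: "d = circumcentric_direction (conical_hull ((\<lambda>j. gradient (\<lambda>x. g x $ j) xbar) ` J))"
    and v: "norm v < (norm d)\<^sup>2"
  shows "\<exists>\<delta>>0. \<forall>t\<in>{0..\<delta>}. xbar + t *\<^sub>R (d + v) \<in> \<Omega>"
proof -
  let ?D = "\<lambda>j. gradient (\<lambda>x. g x $ j) xbar"
  let ?\<phi> = "\<lambda>j t. g (xbar + t *\<^sub>R (d + v)) $ j"
  have D: "GDERIV (\<lambda>x. g x $ j) xbar :> ?D j" for j
    using differentiable by (rule GDERIV_gradient)
  have \<phi>: "(?\<phi> j has_real_derivative (d + v) \<bullet> ?D j) (at 0)" for j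
    using D by (rule GDERIV_along_line)
  have "\<forall>\<^sub>F t in at_right 0. ?\<phi> j t < 0" for j
  proof (cases "j \<in> J")
    case True
    then have zero: "g xbar $ j = 0" by (simp add: J)
    obtain xhat where "g xhat $ j < 0" using Slater by blast
    \<comment> \<open>A zero gradient would make \<open>xbar\<close> a global minimizer with value
      0, against the Slater point.\<close>
    with convex_on_above_GDERIV[OF convex D, of j xhat] zero have "?D j \<noteq> 0" by auto
    with True have "(d + v) \<bullet> ?D j < 0"
      by (intro inner_circumcentric_direction_neg[OF _ d v]) auto
    from DERIV_neg_dec_right[OF \<phi> this]
    obtain e where "e > 0" "\<forall>h>0. h < e \<longrightarrow> ?\<phi> j h < 0"
      using zero by auto
    then show ?thesis by (auto simp: eventually_at_right_field)
  next
    case False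
    \<comment> \<open>An inactive constraint is strict at \<open>xbar\<close> and stays so nearby by
      continuity.\<close>
    then have "?\<phi> j 0 < 0" using xbar by (simp add: J Omega order_less_le)
    moreover have "(?\<phi> j \<longlongrightarrow> ?\<phi> j 0) (at_right 0)"
      using DERIV_isCont[OF \<phi>] by (simp add: isCont_def filterlim_at_split)
    ultimately show ?thesis by (rule order_tendstoD(2)[rotated])
  qed
  then have "\<forall>\<^sub>F t in at_right 0. \<forall>j. ?\<phi> j t < 0"
    by (rule eventually_all_finite)
  then obtain e where e: "e > 0" "\<And>t j. 0 < t \<Longrightarrow> t < e \<Longrightarrow> ?\<phi> j t < 0"
    by (auto simp: eventually_at_right_field)
  \<comment> \<open>Halving \<open>e\<close> fits a closed interval inside \<open>t < e\<close>. The
    endpoint \<open>t = 0\<close> is separate, as active constraints vanish there.\<close>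
  have "xbar + t *\<^sub>R (d + v) \<in> \<Omega>" if "t \<in> {0..e / 2}" for t
  proof (cases "t = 0")
    case True
    then show ?thesis using xbar by simp
  next
    case False
    then show ?thesis using that e by (auto simp: Omega intro: order_less_imp_le)
  qed
  with e(1) show ?thesis by (intro exI[of _ "e / 2"]) auto
qed

end
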